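(* Let $(X,x_0)$ be a based digital image. If $X$ is subdivision-based contractible, then $\pi_1(X;x_0)\cong\{\mathbf{e}\}$, the trivial group.
   Context: A digital image is a finite subset $X \subseteq \mathbb{Z}^n$ with adjacency relation $x \sim_X x'$ iff $|x_i - x'_i| \le 1$ for every $i=1,\dots,n$. A function of digital images is continuous if it sends adjacent points to adjacent points; a based map is a continuous function preserving basepoints. $I_N = \{0,1,\dots,N\}\subseteq\mathbb{Z}$; products of digital images are Cartesian products with adjacency in each factor. Based maps $f,g\colon X\to Y$ are based homotopic, $f\approx g$, if for some $N\ge1$ there is a continuous $H\colon X\times I_N\to Y$ with $H(x,0)=f(x)$, $H(x,N)=g(x)$ for all $x$ and $H(x_0,t)=y_0$ for all $t$. For $k\ge1$, the $k$-subdivision of $X\subseteq\mathbb{Z}^n$ is $S(X,k)=\{(y_1,\dots,y_n)\in\mathbb{Z}^n : (\lfloor y_1/k\rfloor,\dots,\lfloor y_n/k\rfloor)\in X\}$, with continuous standard projection $\rho_k\colon S(X,k)\to X$, $\rho_k(y_1,\dots,y_n)=(\lfloor y_1/k\rfloor,\dots,\lfloor y_n/k\rfloor)$ ($S(X,1)=X$, $\rho_1=\mathrm{id}$). One identifies $S(S(X,k),k')=S(X,kk')$, so there is also $\rho_{k'}\colon S(X,kk')\to S(X,k)$. If $X$ has basepoint $x_0=(a_1,\dots,a_n)$, the basepoint of $S(X,k)$ is $\overline{x_0}=(ka_1+c,\dots,ka_n+c)$, $c=\lfloor (k-1)/2\rfloor$. Based maps $f\colon S(X,k)\to Y$ and $g\colon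 S(X,l)\to Y$ are subdivision-based homotopic if, for some $k',l'\ge1$ with $kk'=ll'=m$, there is a based homotopy $f\circ\rho_{k'}\approx g\circ\rho_{l'}\colon S(X,m)\to Y$. Based digital images $X$ and $Y$ are subdivision-based homotopy equivalent if for some $k,l\ge1$ there are: (a) based maps $f\colon S(X,k)\to Y$ and $g\colon S(Y,l)\to X$; (b) based maps $F\colon S(X,kl)\to S(Y,l)$ and $G\colon S(Y,kl)\to S(X,k)$ with $\rho_l\circ F=f\circ\rho_l$ (as maps $S(X,kl)\to Y$) and $\rho_k\circ G=g\circ\rho_k$ (as maps $S(Y,kl)\to X$); (c) $f\circ G\colon S(Y,kl)\to Y$ is subdivision-based homotopic to $\mathrm{id}_Y$ and $g\circ F\colon S(X,kl)\to X$ is subdivision-based homotopic to $\mathrm{id}_X$. A based digital image $X\subseteq\mathbb{Z}^m$ is subdivision-based contractible if it is subdivision-based homotopy equivalent to some one-point digital image $\{y_0\}\subseteq\mathbb{Z}^n$. Fundamental group: for a based digital image $(Y,y_0)$, a based loop of length $N\ge 1$ is a continuous $\gamma\colon I_N\to Y$ with $\gamma(0)=\gamma(N)=y_0$. Based loops $\alpha,\beta\colon I_M\to Y$ are based homotopic as based loops, $\alpha\approx\beta$, if for some $R\ge1$ there is a continuous $H\colon I_M\times I_R\to Y$ with $H(s,0)=\alpha(s)$, $H(s,R)=\beta(s)$ and $H(0,t)=H(M,t)=y_0$ for all $s,t$. With $\rho_k\colon I_{kN+k-1}\to I_N$, $\rho_k(s)=\lfloor s/k\rfloor$, based loops $\alpha\colon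 I_M\to Y$, $\beta\colon I_N\to Y$ are subdivision-based homotopic as based loops if for some $k,l\ge1$ with $k(M+1)=l(N+1)$ we have $\alpha\circ\rho_k\approx\beta\circ\rho_l$ as based loops. This is an equivalence relation; $[\alpha]$ is the class of $\alpha$ and $\pi_1(Y;y_0)$ the set of classes, a group under $[\alpha]\cdot[\beta]=[\alpha\cdot\beta]$, where $\alpha\cdot\beta\colon I_{M+N+1}\to Y$ is $\alpha(t)$ for $0\le t\le M$ and $\beta(t-(M+1))$ for $M+1\le t\le M+N+1$. *)

theory Defs
  imports "HOL-Algebra.Elementary_Groups" "HOL-Library.FuncSet"
begin

section \<open>Digital images and continuity\<close>

text \<open>A point of \<open>\<int>\<^sup>n\<close> is an integer list of length \<open>n\<close>, so that images of different
  dimensions have the same type and the dimension can be quantified over.\<close>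

definition digital_image :: "nat \<Rightarrow> int list set \<Rightarrow> bool" where
  "digital_image n X \<longleftrightarrow> finite X \<and> (\<forall>x\<in>X. length x = n)"

definition based_digital_image :: "nat \<Rightarrow> int list set \<Rightarrow> int list \<Rightarrow> bool" where
  "based_digital_image n X x0 \<longleftrightarrow> digital_image n X \<and> x0 \<in> X"

text \<open>Adjacency is reflexive.  The interval \<open>I\<^sub>N\<close> is \<open>{0..N}\<close> with \<open>int_adj\<close>, and products
  with an interval are sets of pairs with adjacency in each factor.\<close>

definition int_adj :: "int \<Rightarrow> int \<Rightarrow> bool" where
  "int_adj a b \<longleftrightarrow> \<bar>a - b\<bar> \<le> 1"

definition lattice_adj :: "int list \<Rightarrow> int list \<Rightarrow> bool" where
  "lattice_adj x y \<longleftrightarrow> list_all2 int_adj x y"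

definition prod_adj ::
  "('a \<Rightarrow> 'a \<Rightarrow> bool) \<Rightarrow> ('b \<Rightarrow> 'b \<Rightarrow> bool) \<Rightarrow> 'a \<times> 'b \<Rightarrow> 'a \<times> 'b \<Rightarrow> bool" where
  "prod_adj r s p q \<longleftrightarrow> r (fst p) (fst q) \<and> s (snd p) (snd q)"

text \<open>Maps between images are total HOL functions of which only the values on the domain image
  are ever used.\<close>

definition digitally_continuous ::
  "('a \<Rightarrow> 'a \<Rightarrow> bool) \<Rightarrow> 'a set \<Rightarrow> int list set \<Rightarrow> ('a \<Rightarrow> int list) \<Rightarrow> bool" where
  "digitally_continuous r X Y f \<longleftrightarrow>
     f \<in> X \<rightarrow> Y \<and> (\<forall>x\<in>X. \<forall>x'\<in>X. r x x' \<longrightarrow> lattice_adj (f x) (f x'))"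

definition based_map ::
  "int list set \<Rightarrow> int list \<Rightarrow> int list set \<Rightarrow> int list \<Rightarrow> (int list \<Rightarrow> int list) \<Rightarrow> bool" where
  "based_map X x0 Y y0 f \<longleftrightarrow> digitally_continuous lattice_adj X Y f \<and> f x0 = y0"

definition based_homotopic ::
  "int list set \<Rightarrow> int list \<Rightarrow> int list set \<Rightarrow> int list \<Rightarrow>
   (int list \<Rightarrow> int list) \<Rightarrow> (int list \<Rightarrow> int list) \<Rightarrow> bool" where
  "based_homotopic X x0 Y y0 f g \<longleftrightarrow>
     (\<exists>N\<ge>1. \<exists>H. digitally_continuous (prod_adj lattice_adj int_adj) (X \<times> {0..N}) Y H \<and>
        (\<forall>x\<in>X. H (x, 0) = f x \<and> H (x, N) = g x) \<and>
        (\<forall>t\<in>{0..N}. H (x0, t) = y0))"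

section \<open>Subdivision\<close>

text \<open>\<open>div\<close> on \<open>int\<close> rounds towards minus infinity (for positive divisors), so it is
  \<open>\<lfloor>y/k\<rfloor>\<close> for negative coordinates as well.\<close>

definition std_proj :: "int \<Rightarrow> int list \<Rightarrow> int list" where
  "std_proj k y = map (\<lambda>a. a div k) y"

definition subdivision :: "int list set \<Rightarrow> int \<Rightarrow> int list set" where
  "subdivision X k = {y. std_proj k y \<in> X}"

definition subdivision_basepoint :: "int list \<Rightarrow> int \<Rightarrow> int list" where
  "subdivision_basepoint x0 k = map (\<lambda>a. k * a + (k - 1) div 2) x0"

definition subdivision_based_homotopic ::
  "int list set \<Rightarrow> int list \<Rightarrow> int list set \<Rightarrow> int list \<Rightarrow>
   int \<Rightarrow> (int list \<Rightarrow> int list) \<Rightarrow> int \<Rightarrow> (int list \<Rightarrow> int list) \<Rightarrow> bool" where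
  "subdivision_based_homotopic X x0 Y y0 k f l g \<longleftrightarrow>
     (\<exists>k'\<ge>1. \<exists>l'\<ge>1. k * k' = l * l' \<and>
        based_homotopic (subdivision X (k * k')) (subdivision_basepoint x0 (k * k')) Y y0
          (f \<circ> std_proj k') (g \<circ> std_proj l'))"

text \<open>\<open>id\<close> enters as a map on the \<open>1\<close>-subdivision \<open>S(Y,1) = Y\<close>.\<close>

definition subdivision_based_homotopy_equivalent ::
  "int list set \<Rightarrow> int list \<Rightarrow> int list set \<Rightarrow> int list \<Rightarrow> bool" where
  "subdivision_based_homotopy_equivalent X x0 Y y0 \<longleftrightarrow>
     (\<exists>k\<ge>1. \<exists>l\<ge>1. \<exists>f g F G.
        based_map (subdivision X k) (subdivision_basepoint x0 k) Y y0 f \<and>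
        based_map (subdivision Y l) (subdivision_basepoint y0 l) X x0 g \<and>
        based_map (subdivision X (k * l)) (subdivision_basepoint x0 (k * l))
          (subdivision Y l) (subdivision_basepoint y0 l) F \<and>
        based_map (subdivision Y (k * l)) (subdivision_basepoint y0 (k * l))
          (subdivision X k) (subdivision_basepoint x0 k) G \<and>
        (\<forall>x\<in>subdivision X (k * l). std_proj l (F x) = f (std_proj l x)) \<and>
        (\<forall>y\<in>subdivision Y (k * l). std_proj k (G y) = g (std_proj k y)) \<and>
        subdivision_based_homotopic Y y0 Y y0 (k * l) (f \<circ> G) 1 id \<and>
        subdivision_based_homotopic X x0 X x0 (k * l) (g \<circ> F) 1 id)"

definition subdivision_based_contractible :: "int list set \<Rightarrow> int list \<Rightarrow> bool" where
  "subdivision_based_contractible X x0 \<longleftrightarrow>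
     (\<exists>n y0. based_digital_image n {y0} y0 \<and>
        subdivision_based_homotopy_equivalent X x0 {y0} y0)"

section \<open>The digital fundamental group\<close>

text \<open>A loop is stored together with its length, as a function on \<open>I\<^sub>N\<close> extended by
  \<open>undefined\<close>, so that loops agreeing on \<open>I\<^sub>N\<close> are equal.\<close>

type_synonym digital_loop = "int \<times> (int \<Rightarrow> int list)"

definition based_loops :: "int list set \<Rightarrow> int list \<Rightarrow> digital_loop set" where
  "based_loops Y y0 = {(N, \<gamma>). N \<ge> 1 \<and> \<gamma> \<in> extensional {0..N} \<and>
     digitally_continuous int_adj {0..N} Y \<gamma> \<and> \<gamma> 0 = y0 \<and> \<gamma> N = y0}"

definition loop_homotopic ::
  "int list set \<Rightarrow> int list \<Rightarrow> int \<Rightarrow> (int \<Rightarrow> int list) \<Rightarrow> (int \<Rightarrow> int list) \<Rightarrow> bool" where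
  "loop_homotopic Y y0 M \<alpha> \<beta> \<longleftrightarrow>
     (\<exists>R\<ge>1. \<exists>H. digitally_continuous (prod_adj int_adj int_adj) ({0..M} \<times> {0..R}) Y H \<and>
        (\<forall>s\<in>{0..M}. H (s, 0) = \<alpha> s \<and> H (s, R) = \<beta> s) \<and>
        (\<forall>t\<in>{0..R}. H (0, t) = y0 \<and> H (M, t) = y0))"

definition loop_rel :: "int list set \<Rightarrow> int list \<Rightarrow> (digital_loop \<times> digital_loop) set" where
  "loop_rel Y y0 = {((M, \<alpha>), (N, \<beta>)).
     (M, \<alpha>) \<in> based_loops Y y0 \<and> (N, \<beta>) \<in> based_loops Y y0 \<and>
     (\<exists>k\<ge>1. \<exists>l\<ge>1. k * (M + 1) = l * (N + 1) \<and>
        loop_homotopic Y y0 (k * M + k - 1) (\<lambda>s. \<alpha> (s div k)) (\<lambda>s. \<beta> (s div l)))}"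

fun loop_concat :: "digital_loop \<Rightarrow> digital_loop \<Rightarrow> digital_loop" where
  "loop_concat (M, \<alpha>) (N, \<beta>) =
     (M + N + 1, \<lambda>t\<in>{0..M + N + 1}. if t \<le> M then \<alpha> t else \<beta> (t - (M + 1)))"

definition constant_loop :: "int list \<Rightarrow> digital_loop" where
  "constant_loop y0 = (1, \<lambda>t\<in>{0..1}. y0)"

text \<open>The product of two classes is given as the union of the classes of all products of
  representatives; since the product respects \<open>loop_rel\<close>, these classes all coincide.\<close>

definition fundamental_group :: "int list set \<Rightarrow> int list \<Rightarrow> digital_loop set monoid" where
  "fundamental_group Y y0 =
     \<lparr>carrier = based_loops Y y0 // loop_rel Y y0,
      monoid.mult = (\<lambda>A B. \<Union>p\<in>A. \<Union>q\<in>B. loop_rel Y y0 `` {loop_concat p q}),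
      one = loop_rel Y y0 `` {constant_loop y0}\<rparr>"

end

theory Submission
  imports Defs
begin

text \<open>
  Contracting \<open>X\<close> to a point makes the standard projection of some subdivision null-homotopic:
  for some \<open>m\<close>, the map \<open>\<rho>\<^sub>m : S(X,m) \<rightarrow> X\<close> is based homotopic to the constant map at \<open>x0\<close>.
  Indeed \<open>\<rho>\<^sub>m\<close> is homotopic to a map that factors through the subdivision \<open>S({y0},l)\<close> of a
  point.  This is a solid cube, and a cube shrinks onto any one of its points by clamping every
  coordinate into an interval of decreasing radius
  (\<open>nullhomotopic_through_subdivided_point\<close>, \<open>contractible_imp_std_proj_nullhomotopic\<close>).

  General maps into \<open>X\<close> do not lift through \<open>\<rho>\<^sub>m\<close>, but paths do once they are slowed down:
  for \<open>K \<ge> 2m\<close> a loop \<open>\<gamma>\<close> of length \<open>M\<close> has a lift \<open>p\<close>, defined on the \<open>K\<close>-subdivision of its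
  domain, with \<open>\<rho>\<^sub>m \<circ> p = \<gamma> \<circ> \<rho>\<^sub>K\<close> and with both ends at the basepoint of \<open>S(X,m)\<close>.  While \<open>\<gamma>\<close>
  rests at \<open>x\<close>, the lift runs from the wall shared with the preceding block to the centre of the
  block over \<open>x\<close> and then on to the wall shared with the following block (\<open>path_lift\<close>).
  Composing the null-homotopy of \<open>\<rho>\<^sub>m\<close> with \<open>p\<close> shows that \<open>\<gamma> \<circ> \<rho>\<^sub>K\<close> is null-homotopic for every
  \<open>K \<ge> 2m\<close> (\<open>loop_nullhomotopic_after_subdivision\<close>).

  Because every large \<open>K\<close> works, two loops of different lengths can be brought to the same length
  by such subdivisions, where both are homotopic to the constant loop.  So the relation \<open>loop_rel\<close>
  identifies all based loops, there is a single class, and the group is trivial.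
\<close>

section \<open>Adjacency and standard projections\<close>

lemma int_adj_div:
  assumes "int_adj a b" "1 \<le> k"
  shows "int_adj (a div k) (b div k)"
proof -
  have "\<bar>a div k - b div k\<bar> \<le> 1" if "a \<le> b" "b \<le> a + 1" for a b :: int
  proof -
    have "a div k \<le> b div k" "b div k \<le> (a + k) div k"
      using that assms(2) by (auto intro: zdiv_mono1)
    moreover have "(a + k) div k = a div k + 1" using assms(2) div_add_self2[of k a] by auto
    ultimately show ?thesis by linarith
  qed
  from this[of a b] this[of b a] assms(1) show ?thesis
    unfolding int_adj_def by linarith
qed

lemma lattice_adj_refl: "lattice_adj x x"
  by (simp add: lattice_adj_def int_adj_def list_all2_refl)

lemma lattice_adj_sym: "lattice_adj x y \<Longrightarrow> lattice_adj y x"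
  by (auto simp: lattice_adj_def int_adj_def list_all2_conv_all_nth abs_minus_commute)

lemma lattice_adj_std_proj:
  assumes "lattice_adj x y" "1 \<le> k"
  shows "lattice_adj (std_proj k x) (std_proj k y)"
  using assms by (auto simp: lattice_adj_def std_proj_def list_all2_conv_all_nth int_adj_div)

lemma std_proj_std_proj: "1 \<le> k \<Longrightarrow> 1 \<le> l \<Longrightarrow> std_proj k (std_proj l x) = std_proj (k * l) x"
  by (simp add: std_proj_def zdiv_zmult2_eq mult.commute[of k l])

text \<open>Adjacency being reflexive and symmetric, a path has to be checked on unit steps only.\<close>

lemma continuous_on_interval:
  assumes into: "\<And>s. s \<in> {0..N} \<Longrightarrow> \<gamma> s \<in> Y"
    and step: "\<And>s. 0 \<le> s \<Longrightarrow> s < N \<Longrightarrow> lattice_adj (\<gamma> s) (\<gamma> (s + 1))"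
  shows "digitally_continuous int_adj {0..N} Y \<gamma>"
  unfolding digitally_continuous_def
proof (intro conjI ballI impI)
  fix s s' assume s: "s \<in> {0..N}" "s' \<in> {0..N}" "int_adj s s'"
  then consider "s' = s" | "s' = s + 1" | "s = s' + 1"
    unfolding int_adj_def by linarith
  then show "lattice_adj (\<gamma> s) (\<gamma> s')"
    using s step[of s] step[of s'] by cases (auto intro: lattice_adj_refl lattice_adj_sym)
qed (use into in auto)

section \<open>Composing and reversing homotopies\<close>

text \<open>Times that are adjacent lie both before or both after the instant \<open>R\<close> at which the two
  homotopies agree, so no adjacency ever has to be compared across the two.\<close>

lemma homotopy_concat:
  assumes H: "digitally_continuous (prod_adj r int_adj) (A \<times> {0..R}) Y H"
    and H': "digitally_continuous (prod_adj r int_adj) (A \<times> {0..R'}) Y H'"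
    and R: "0 \<le> R" "0 \<le> R'"
    and agree: "\<And>a. a \<in> A \<Longrightarrow> H (a, R) = H' (a, 0)"
  shows "digitally_continuous (prod_adj r int_adj) (A \<times> {0..R + R'}) Y
    (\<lambda>(a, t). if t \<le> R then H (a, t) else H' (a, t - R))" (is "digitally_continuous _ _ _ ?C")
proof -
  have low: "?C (a, t) = H (a, t)" if "t \<le> R" for a t using that by simp
  have high: "?C (a, t) = H' (a, t - R)" if "a \<in> A" "R \<le> t" for a t
    using that agree by (cases "t = R") auto
  have into: "?C (a, t) \<in> Y" if "a \<in> A" "t \<in> {0..R + R'}" for a t
  proof (cases "t \<le> R")
    case True
    then show ?thesis using that H by (auto simp: digitally_continuous_def)
  next
    case False
    then have "(a, t - R) \<in> A \<times> {0..R'}" using that by auto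
    with False H' show ?thesis by (auto simp: digitally_continuous_def)
  qed
  have adj: "lattice_adj (?C (a, t)) (?C (a', t'))"
    if "a \<in> A" "a' \<in> A" "t \<in> {0..R + R'}" "t' \<in> {0..R + R'}" "r a a'" "int_adj t t'" for a a' t t'
  proof -
    from that(6) consider "t \<le> R" "t' \<le> R" | "R \<le> t" "R \<le> t'"
      unfolding int_adj_def by linarith
    then show ?thesis
    proof cases
      case 1
      have "lattice_adj (H (a, t)) (H (a', t'))"
        using H that 1 unfolding digitally_continuous_def prod_adj_def by simp
      with 1 show ?thesis by simp
    next
      case 2
      have "(a, t - R) \<in> A \<times> {0..R'}" "(a', t' - R) \<in> A \<times> {0..R'}"
        "int_adj (t - R) (t' - R)"
        using that 2 by (auto simp: int_adj_def)
      then have "lattice_adj (H' (a, t - R)) (H' (a', t' - R))"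
        using H' that(5) unfolding digitally_continuous_def prod_adj_def by simp
      then show ?thesis using high that 2 by simp
    qed
  qed
  show ?thesis
    unfolding digitally_continuous_def
    using into adj by (auto simp: prod_adj_def simp del: split_conv)
qed

lemma based_homotopic_trans:
  assumes "based_homotopic X x0 Y y0 f g" "based_homotopic X x0 Y y0 g h"
  shows "based_homotopic X x0 Y y0 f h"
proof -
  from assms(1) obtain R H where R: "1 \<le> R"
    and H: "digitally_continuous (prod_adj lattice_adj int_adj) (X \<times> {0..R}) Y H"
      "\<forall>x\<in>X. H (x, 0) = f x \<and> H (x, R) = g x" "\<forall>t\<in>{0..R}. H (x0, t) = y0"
    unfolding based_homotopic_def by blast
  from assms(2) obtain R' H' where R': "1 \<le> R'"
    and H': "digitally_continuous (prod_adj lattice_adj int_adj) (X \<times> {0..R'}) Y H'"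
      "\<forall>x\<in>X. H' (x, 0) = g x \<and> H' (x, R') = h x" "\<forall>t\<in>{0..R'}. H' (x0, t) = y0"
    unfolding based_homotopic_def by blast
  have concat: "digitally_continuous (prod_adj lattice_adj int_adj) (X \<times> {0..R + R'}) Y
      (\<lambda>(a, t). if t \<le> R then H (a, t) else H' (a, t - R))"
    using R R' H(2) H'(2) by (intro homotopy_concat[OF H(1) H'(1)]) auto
  show ?thesis
    unfolding based_homotopic_def
    by (intro exI[of _ "R + R'"]
        exI[of _ "\<lambda>(a, t). if t \<le> R then H (a, t) else H' (a, t - R)"] conjI concat)
      (use R R' H H' in auto)
qed

lemma loop_homotopic_trans:
  assumes "loop_homotopic Y y0 M \<alpha> \<beta>" "loop_homotopic Y y0 M \<beta> \<gamma>"
  shows "loop_homotopic Y y0 M \<alpha> \<gamma>"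
proof -
  from assms(1) obtain R H where R: "1 \<le> R"
    and H: "digitally_continuous (prod_adj int_adj int_adj) ({0..M} \<times> {0..R}) Y H"
      "\<forall>s\<in>{0..M}. H (s, 0) = \<alpha> s \<and> H (s, R) = \<beta> s"
      "\<forall>t\<in>{0..R}. H (0, t) = y0 \<and> H (M, t) = y0"
    unfolding loop_homotopic_def by blast
  from assms(2) obtain R' H' where R': "1 \<le> R'"
    and H': "digitally_continuous (prod_adj int_adj int_adj) ({0..M} \<times> {0..R'}) Y H'"
      "\<forall>s\<in>{0..M}. H' (s, 0) = \<beta> s \<and> H' (s, R') = \<gamma> s"
      "\<forall>t\<in>{0..R'}. H' (0, t) = y0 \<and> H' (M, t) = y0"
    unfolding loop_homotopic_def by blast
  have concat: "digitally_continuous (prod_adj int_adj int_adj) ({0..M} \<times> {0..R + R'}) Y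
      (\<lambda>(a, t). if t \<le> R then H (a, t) else H' (a, t - R))"
    using R R' H(2) H'(2) by (intro homotopy_concat[OF H(1) H'(1)]) auto
  show ?thesis
    unfolding loop_homotopic_def
    by (intro exI[of _ "R + R'"]
        exI[of _ "\<lambda>(a, t). if t \<le> R then H (a, t) else H' (a, t - R)"] conjI concat)
      (use R R' H H' in auto)
qed

lemma loop_homotopic_sym:
  assumes "loop_homotopic Y y0 M \<alpha> \<beta>"
  shows "loop_homotopic Y y0 M \<beta> \<alpha>"
proof -
  from assms obtain R H where R: "1 \<le> R"
    and H: "digitally_continuous (prod_adj int_adj int_adj) ({0..M} \<times> {0..R}) Y H"
      "\<forall>s\<in>{0..M}. H (s, 0) = \<alpha> s \<and> H (s, R) = \<beta> s"
      "\<forall>t\<in>{0..R}. H (0, t) = y0 \<and> H (M, t) = y0"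
    unfolding loop_homotopic_def by blast
  have "digitally_continuous (prod_adj int_adj int_adj) ({0..M} \<times> {0..R}) Y
      (\<lambda>(s, t). H (s, R - t))"
    using H(1) unfolding digitally_continuous_def prod_adj_def int_adj_def by (auto simp: Pi_iff)
  then show ?thesis
    unfolding loop_homotopic_def
    by (intro exI[of _ R] exI[of _ "\<lambda>(s, t). H (s, R - t)"]) (use R H in auto)
qed

section \<open>Contracting the subdivision of a point\<close>

text \<open>Moving every coordinate of \<open>z\<close> towards \<open>z0\<close> at unit speed would not be continuous, because
  product adjacency allows space and time to change at once and the two changes can add up to a
  jump of size 2.  Clamping avoids this: \<open>max\<close> and \<open>min\<close> are nonexpansive for the maximum
  distance, so the result is jointly continuous in the point and the radius \<open>t\<close>.\<close>

definition clamp_within :: "int \<Rightarrow> int list \<Rightarrow> int list \<Rightarrow> int list" where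
  "clamp_within t z0 z = map2 (\<lambda>c a. max (c - t) (min (c + t) a)) z0 z"

lemma lattice_adj_clamp_within:
  assumes "lattice_adj z z'" "int_adj t t'"
  shows "lattice_adj (clamp_within t z0 z) (clamp_within t' z0 z')"
  using assms by (auto simp: lattice_adj_def clamp_within_def list_all2_conv_all_nth int_adj_def)

lemma clamp_within_self: "0 \<le> t \<Longrightarrow> clamp_within t z z = z"
  by (auto simp: clamp_within_def intro!: nth_equalityI)

lemma clamp_within_zero: "length z0 = length z \<Longrightarrow> clamp_within 0 z0 z = z0"
  by (auto simp: clamp_within_def intro!: nth_equalityI)

text \<open>The subdivision of a point is a cube with side length \<open>l\<close>.\<close>

lemma mem_subdivision_point_iff:
  assumes "1 \<le> l"
  shows "z \<in> subdivision {y} l \<longleftrightarrow>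
    length z = length y \<and> (\<forall>i<length y. l * y ! i \<le> z ! i \<and> z ! i < l * y ! i + l)"
proof -
  have "a div l = b \<longleftrightarrow> l * b \<le> a \<and> a < l * b + l" for a b :: int
  proof
    assume "a div l = b"
    moreover have "a mod l < l" "0 \<le> a mod l" "a = l * (a div l) + a mod l" using assms by auto
    ultimately show "l * b \<le> a \<and> a < l * b + l" by auto
  next
    assume "l * b \<le> a \<and> a < l * b + l"
    then show "a div l = b" using assms by (intro int_div_pos_eq[of a l b "a - l * b"]) auto
  qed
  then show ?thesis
    by (auto simp: subdivision_def std_proj_def list_eq_iff_nth_eq)
qed

lemma clamp_within_mem_subdivision_point:
  assumes "1 \<le> l" "0 \<le> t" "z0 \<in> subdivision {y} l" "z \<in> subdivision {y} l"
  shows "clamp_within t z0 z \<in> subdivision {y} l"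
proof -
  have "l * y ! i \<le> max (z0 ! i - t) (min (z0 ! i + t) (z ! i)) \<and>
      max (z0 ! i - t) (min (z0 ! i + t) (z ! i)) < l * y ! i + l" if "i < length y" for i
  proof -
    have "l * y ! i \<le> z0 ! i" "z0 ! i < l * y ! i + l"
      "l * y ! i \<le> z ! i" "z ! i < l * y ! i + l"
      using assms that by (auto simp: mem_subdivision_point_iff)
    with assms(2) show ?thesis by linarith
  qed
  with assms show ?thesis by (simp add: mem_subdivision_point_iff clamp_within_def)
qed

text \<open>Two points of a cube of side length \<open>l\<close> differ by less than \<open>l\<close> in each coordinate, so
  clamping at radius \<open>l\<close> changes nothing.\<close>

lemma clamp_within_full:
  assumes "1 \<le> l" "z0 \<in> subdivision {y} l" "z \<in> subdivision {y} l"
  shows "clamp_within l z0 z = z"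
proof (rule nth_equalityI)
  fix i assume i: "i < length (clamp_within l z0 z)"
  then have "l * y ! i \<le> z0 ! i" "z0 ! i < l * y ! i + l"
    "l * y ! i \<le> z ! i" "z ! i < l * y ! i + l"
    using assms by (auto simp: mem_subdivision_point_iff clamp_within_def)
  then have "max (z0 ! i - l) (min (z0 ! i + l) (z ! i)) = z ! i" by linarith
  with i show "clamp_within l z0 z ! i = z ! i" by (simp add: clamp_within_def)
qed (use assms in \<open>auto simp: mem_subdivision_point_iff clamp_within_def\<close>)

text \<open>The radius of the clamping serves as the time of the homotopy.  The cube is contracted to
  \<open>d a0\<close>, so the image of \<open>a0\<close> stays fixed whichever point of the cube \<open>d a0\<close> is.\<close>

lemma nullhomotopic_through_subdivided_point:
  assumes l: "1 \<le> l"
    and d: "digitally_continuous lattice_adj A (subdivision {y} l) d"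
    and g: "digitally_continuous lattice_adj (subdivision {y} l) Y g"
    and a0: "a0 \<in> A"
  shows "based_homotopic A a0 Y (g (d a0)) (\<lambda>_. g (d a0)) (g \<circ> d)"
proof -
  have mem: "d a \<in> subdivision {y} l" if "a \<in> A" for a
    using d that by (auto simp: digitally_continuous_def)
  have clamp: "clamp_within t (d a0) (d a) \<in> subdivision {y} l" if "a \<in> A" "0 \<le> t" for a t
    using clamp_within_mem_subdivision_point[OF l that(2) mem[OF a0] mem[OF that(1)]] .
  let ?H = "\<lambda>(a, t). g (clamp_within t (d a0) (d a))"
  have "digitally_continuous (prod_adj lattice_adj int_adj) (A \<times> {0..l}) Y ?H"
    unfolding digitally_continuous_def
  proof (intro conjI ballI impI funcsetI)
    fix p assume "p \<in> A \<times> {0..l}"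
    then have "clamp_within (snd p) (d a0) (d (fst p)) \<in> subdivision {y} l"
      by (intro clamp) auto
    then show "?H p \<in> Y"
      using g by (simp add: digitally_continuous_def Pi_iff split_beta)
  next
    fix p q assume p: "p \<in> A \<times> {0..l}" and q: "q \<in> A \<times> {0..l}"
      and adj: "prod_adj lattice_adj int_adj p q"
    have "lattice_adj (clamp_within (snd p) (d a0) (d (fst p))) (clamp_within (snd q) (d a0) (d (fst q)))"
      using d p q adj by (intro lattice_adj_clamp_within) (auto simp: digitally_continuous_def prod_adj_def)
    moreover have "clamp_within (snd p) (d a0) (d (fst p)) \<in> subdivision {y} l"
      "clamp_within (snd q) (d a0) (d (fst q)) \<in> subdivision {y} l"
      using p q by (auto intro!: clamp)
    ultimately show "lattice_adj (?H p) (?H q)"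
      using g by (simp add: digitally_continuous_def split_beta)
  qed
  moreover have "clamp_within 0 (d a0) (d a) = d a0" if "a \<in> A" for a
    using mem[OF a0] mem[OF that] l by (simp add: clamp_within_zero mem_subdivision_point_iff)
  moreover have "clamp_within l (d a0) (d a) = d a" if "a \<in> A" for a
    using clamp_within_full[OF l mem[OF a0] mem[OF that]] .
  ultimately show ?thesis
    unfolding based_homotopic_def
    by (intro exI[of _ l] exI[of _ ?H])
      (use l in \<open>auto simp: clamp_within_self\<close>)
qed

lemma subdivision_basepoint_mem:
  assumes "1 \<le> m" "x0 \<in> X"
  shows "subdivision_basepoint x0 m \<in> subdivision X m"
proof -
  have "(m * a + (m - 1) div 2) div m = a" for a
    using assms(1) by (intro int_div_pos_eq[of _ m _ "(m - 1) div 2"]) auto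
  with assms(2) show ?thesis
    by (simp add: subdivision_def subdivision_basepoint_def std_proj_def comp_def)
qed

text \<open>A contraction gives a homotopy from \<open>g \<circ> F \<circ> \<rho>\<^bsub>k'\<^esub>\<close> to \<open>\<rho>\<^sub>m\<close>, and \<open>F\<close> takes its
  values in the subdivision of a point.\<close>

lemma contractible_imp_std_proj_nullhomotopic:
  assumes "subdivision_based_contractible X x0" and x0: "x0 \<in> X"
  obtains m where "1 \<le> m"
    "based_homotopic (subdivision X m) (subdivision_basepoint x0 m) X x0 (\<lambda>_. x0) (std_proj m)"
proof -
  from assms(1) obtain y0 where "subdivision_based_homotopy_equivalent X x0 {y0} y0"
    unfolding subdivision_based_contractible_def by blast
  then obtain k l g F where kl: "1 \<le> k" "1 \<le> l"
    and g: "based_map (subdivision {y0} l) (subdivision_basepoint y0 l) X x0 g"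
    and F: "based_map (subdivision X (k * l)) (subdivision_basepoint x0 (k * l))
          (subdivision {y0} l) (subdivision_basepoint y0 l) F"
    and hom: "subdivision_based_homotopic X x0 X x0 (k * l) (g \<circ> F) 1 id"
    unfolding subdivision_based_homotopy_equivalent_def by blast
  from hom obtain k' where k': "1 \<le> k'" and
    hom': "based_homotopic (subdivision X (k * l * k')) (subdivision_basepoint x0 (k * l * k')) X x0
      (g \<circ> F \<circ> std_proj k') (std_proj (k * l * k'))"
    unfolding subdivision_based_homotopic_def by auto
  let ?m = "k * l * k'"
  let ?b = "subdivision_basepoint x0 ?m"
  let ?d = "F \<circ> std_proj k'"
  have kl1: "1 \<le> k * l" using kl by (simp add: int_one_le_iff_zero_less)
  have m: "1 \<le> ?m" using kl1 k' by (simp add: int_one_le_iff_zero_less)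
  have b: "?b \<in> subdivision X ?m" by (rule subdivision_basepoint_mem[OF m x0])
  have proj: "std_proj k' z \<in> subdivision X (k * l)" if "z \<in> subdivision X ?m" for z
    using that std_proj_std_proj[OF kl1 k'] by (simp add: subdivision_def)
  have d: "digitally_continuous lattice_adj (subdivision X ?m) (subdivision {y0} l) ?d"
    using F proj lattice_adj_std_proj[OF _ k']
    unfolding based_map_def digitally_continuous_def by (simp add: Pi_iff)
  \<comment> \<open>This is read off from the based homotopy at time 0, which avoids comparing the basepoints of
    different subdivisions under the standard projection.\<close>
  have gd: "g (?d ?b) = x0"
  proof -
    from hom' obtain N H where "1 \<le> N" "\<forall>x\<in>subdivision X ?m. H (x, 0) = (g \<circ> F \<circ> std_proj k') x"
      "\<forall>t\<in>{0..N::int}. H (?b, t) = x0"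
      unfolding based_homotopic_def by blast
    with b have "H (?b, 0) = x0" "H (?b, 0) = (g \<circ> F \<circ> std_proj k') ?b" by auto
    then show ?thesis by simp
  qed
  have "based_homotopic (subdivision X ?m) ?b X x0 (\<lambda>_. x0) (g \<circ> ?d)"
    using nullhomotopic_through_subdivided_point[OF kl(2) d _ b, of X g] g
    unfolding gd by (simp add: based_map_def)
  with hom' have "based_homotopic (subdivision X ?m) ?b X x0 (\<lambda>_. x0) (std_proj ?m)"
    by (auto intro: based_homotopic_trans simp: comp_assoc)
  with m that show thesis by blast
qed

section \<open>Lifting loops to a subdivision\<close>

text \<open>One coordinate of the lift inside the block \<open>{m * a ..< m * a + m}\<close> over \<open>a\<close>, at \<open>d\<close> time
  steps from the moment at which the path changes between \<open>a\<close> and the adjacent value \<open>b\<close>.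
  If \<open>b \<noteq> a\<close>, it is at \<open>d = 0\<close> the end of the block that faces the block of \<open>b\<close>, and as \<open>d\<close>
  grows it moves to the centre at unit speed and stays there; if \<open>b = a\<close>, it rests at the
  centre.\<close>

definition lift_coord :: "int \<Rightarrow> int \<Rightarrow> int \<Rightarrow> int \<Rightarrow> int" where
  "lift_coord m d a b = m * a +
     (if b < a then min d ((m - 1) div 2)
      else if a < b then max (m - 1 - d) ((m - 1) div 2)
      else (m - 1) div 2)"

lemma lift_coord_div:
  assumes "1 \<le> m" "0 \<le> d"
  shows "lift_coord m d a b div m = a"
proof -
  let ?r = "lift_coord m d a b - m * a"
  have "0 \<le> ?r" "?r < m" using assms by (auto simp: lift_coord_def min_def max_def)
  then show ?thesis by (intro int_div_pos_eq[of _ m _ ?r]) auto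
qed

lemma lift_coord_lipschitz: "int_adj d d' \<Longrightarrow> int_adj (lift_coord m d a b) (lift_coord m d' a b)"
  by (auto simp: int_adj_def lift_coord_def)

text \<open>After \<open>m - 1\<close> steps the centre is reached from either end of the block.\<close>

lemma lift_coord_deep:
  assumes "1 \<le> m" "m - 1 \<le> d"
  shows "lift_coord m d a b = m * a + (m - 1) div 2"
  using assms by (auto simp: lift_coord_def)

text \<open>The ends of two neighbouring blocks that face each other are adjacent.\<close>

lemma lift_coord_cross:
  assumes "1 \<le> m" "int_adj a b"
  shows "int_adj (lift_coord m 0 a b) (lift_coord m 0 b a)"
proof -
  consider "b = a" | "b = a + 1" | "a = b + 1" using assms(2) unfolding int_adj_def by linarith
  then show ?thesis using assms(1)
    by cases (auto simp: int_adj_def lift_coord_def algebra_simps max_def min_def)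
qed

text \<open>The path \<open>\<gamma>\<close> is at \<open>\<gamma> (s div K)\<close> for \<open>K\<close> time steps.  In the first \<open>m\<close> of them the lift
  comes from the side of the preceding value of \<open>\<gamma>\<close>, in the others it turns to the side of the
  following value; \<open>max 0\<close> and \<open>min M\<close> make \<open>\<gamma>\<close> stationary before its start and after its
  end, so that the lift starts and ends at a centre.\<close>

definition path_lift :: "int \<Rightarrow> int \<Rightarrow> int \<Rightarrow> (int \<Rightarrow> int list) \<Rightarrow> int \<Rightarrow> int list" where
  "path_lift m K M \<gamma> s =
     (if s mod K < m
      then map2 (lift_coord m (s mod K)) (\<gamma> (s div K)) (\<gamma> (max 0 (s div K - 1)))
      else map2 (lift_coord m (K - 1 - s mod K)) (\<gamma> (s div K)) (\<gamma> (min M (s div K + 1))))"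

context
  fixes X :: "int list set" and n :: nat and m K M :: int and \<gamma> :: "int \<Rightarrow> int list"
  assumes len: "\<And>x. x \<in> X \<Longrightarrow> length x = n"
    and cont: "digitally_continuous int_adj {0..M} X \<gamma>"
    and m: "1 \<le> m" and K: "2 * m \<le> K" and M: "0 \<le> M"
begin

lemma block_index:
  assumes "s \<in> {0..K * M + K - 1}"
  shows "s div K \<in> {0..M}"
proof -
  have "0 \<le> s mod K" using K m by simp
  then have "K * (s div K) \<le> s" using mult_div_mod_eq[of K s] by linarith
  then have "K * (s div K) < K * (M + 1)" using assms by (simp add: algebra_simps)
  then have "s div K < M + 1" using K m by (simp add: mult_less_cancel_left)
  then show ?thesis using assms K m by (simp add: pos_imp_zdiv_nonneg_iff)
qed

lemma length_loop_point: "j \<in> {0..M} \<Longrightarrow> length (\<gamma> j) = n"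
  using len cont unfolding digitally_continuous_def by (blast dest: funcset_mem)

lemma std_proj_path_lift:
  assumes "s \<in> {0..K * M + K - 1}"
  shows "std_proj m (path_lift m K M \<gamma> s) = \<gamma> (s div K)"
proof -
  have j: "s div K \<in> {0..M}" by (rule block_index[OF assms])
  then have *: "length (\<gamma> (s div K)) = n" "length (\<gamma> (max 0 (s div K - 1))) = n"
    "length (\<gamma> (min M (s div K + 1))) = n"
    using M by (auto intro!: length_loop_point)
  have "0 \<le> s mod K" "s mod K < K" using K m by auto
  with * m show ?thesis
    by (auto simp: path_lift_def std_proj_def lift_coord_div intro!: nth_equalityI)
qed

lemma path_lift_start: "path_lift m K M \<gamma> 0 = subdivision_basepoint (\<gamma> 0) m"
  using m K by (auto simp: path_lift_def subdivision_basepoint_def lift_coord_def intro!: nth_equalityI)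

lemma path_lift_end: "path_lift m K M \<gamma> (K * M + K - 1) = subdivision_basepoint (\<gamma> M) m"
proof -
  have "(K * M + K - 1) div K = M"
    using K m by (intro int_div_pos_eq[of _ K _ "K - 1"]) auto
  moreover have "(K * M + K - 1) mod K = K - 1"
    using K m by (intro int_mod_pos_eq[of _ K M]) auto
  ultimately show ?thesis
    using m K by (auto simp: path_lift_def subdivision_basepoint_def lift_coord_def intro!: nth_equalityI)
qed

text \<open>Within a block the lift moves at unit speed.  It switches from the preceding to the following
  neighbour between the remainders \<open>m - 1\<close> and \<open>m\<close>, and \<open>K \<ge> 2 * m\<close> guarantees that it is at the
  centre on both sides of this switch.  A change of block is the crossing of a common wall.\<close>

lemma path_lift_continuous:
  "digitally_continuous int_adj {0..K * M + K - 1} (subdivision X m) (path_lift m K M \<gamma>)"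
proof (rule continuous_on_interval)
  fix s assume "s \<in> {0..K * M + K - 1}"
  then show "path_lift m K M \<gamma> s \<in> subdivision X m"
    using std_proj_path_lift block_index cont by (auto simp: subdivision_def digitally_continuous_def)
next
  fix s assume s: "0 \<le> s" "s < K * M + K - 1"
  define j r where "j = s div K" and "r = s mod K"
  have r: "0 \<le> r" "r < K" using K m by (auto simp: r_def)
  have j: "j \<in> {0..M}" using block_index[of s] s by (simp add: j_def)
  have s_eq: "s = K * j + r" by (simp add: j_def r_def)
  have prev: "length (\<gamma> (max 0 (j - 1))) = n" and cur: "length (\<gamma> j) = n"
    and succ: "length (\<gamma> (min M (j + 1))) = n"
    using j by (auto intro!: length_loop_point)
  show "lattice_adj (path_lift m K M \<gamma> s) (path_lift m K M \<gamma> (s + 1))"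
  proof (cases "r = K - 1")
    case True
    have "s + 1 = K * (j + 1)" using True by (simp add: s_eq algebra_simps)
    then have "(s + 1) div K = j + 1" "(s + 1) mod K = 0"
      using K m by auto
    then have next_eq: "path_lift m K M \<gamma> (s + 1) = map2 (lift_coord m 0) (\<gamma> (j + 1)) (\<gamma> j)"
      using m j by (simp add: path_lift_def)
    have "j + 1 \<in> {0..M}" using block_index[of "s + 1"] s \<open>(s + 1) div K = j + 1\<close> by simp
    then have "min M (j + 1) = j + 1" "length (\<gamma> (j + 1)) = n"
      using length_loop_point by auto
    moreover have "lattice_adj (\<gamma> j) (\<gamma> (j + 1))"
      using cont j \<open>j + 1 \<in> {0..M}\<close> by (auto simp: digitally_continuous_def int_adj_def)
    moreover have "path_lift m K M \<gamma> s = map2 (lift_coord m 0) (\<gamma> j) (\<gamma> (min M (j + 1)))"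
      using True K m by (simp add: path_lift_def flip: j_def r_def)
    ultimately show ?thesis
      using next_eq cur m
      by (auto simp: lattice_adj_def list_all2_conv_all_nth intro!: lift_coord_cross)
  next
    case False
    then have "(s + 1) div K = j" "(s + 1) mod K = r + 1"
      using r by (auto simp: s_eq intro!: int_div_pos_eq[of _ K _ "r + 1"] int_mod_pos_eq[of _ K j])
    then show ?thesis
      using prev cur succ m K r
      by (auto simp: path_lift_def lattice_adj_def list_all2_conv_all_nth lift_coord_deep
          int_adj_def[of "_ + _"]
          simp flip: j_def r_def intro!: lift_coord_lipschitz)
        (auto simp: int_adj_def)
  qed
qed

end

section \<open>Triviality of the fundamental group\<close>

text \<open>The null-homotopy of \<open>\<rho>\<^sub>m\<close> is pulled back along the lift; it fixes the end points because the
  lift begins and ends at the basepoint of the subdivision.\<close>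

lemma loop_nullhomotopic_after_subdivision:
  assumes len: "\<And>x. x \<in> X \<Longrightarrow> length x = n"
    and null: "based_homotopic (subdivision X m) (subdivision_basepoint x0 m) X x0
      (\<lambda>_. x0) (std_proj m)"
    and m: "1 \<le> m" and K: "2 * m \<le> K"
    and loop: "(M, \<gamma>) \<in> based_loops X x0"
  shows "loop_homotopic X x0 (K * M + K - 1) (\<lambda>_. x0) (\<lambda>s. \<gamma> (s div K))"
proof -
  from loop have cont: "digitally_continuous int_adj {0..M} X \<gamma>" and M: "0 \<le> M"
    and ends: "\<gamma> 0 = x0" "\<gamma> M = x0"
    by (auto simp: based_loops_def)
  note lift = len cont m K M
  let ?p = "path_lift m K M \<gamma>"
  let ?L = "K * M + K - 1"
  have p: "digitally_continuous int_adj {0..?L} (subdivision X m) ?p"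
    by (rule path_lift_continuous[OF lift])
  have p_ends: "?p 0 = subdivision_basepoint x0 m" "?p ?L = subdivision_basepoint x0 m"
    using path_lift_start[OF lift] path_lift_end[OF lift] ends by simp_all
  from null obtain R H where R: "1 \<le> R"
    and H: "digitally_continuous (prod_adj lattice_adj int_adj) (subdivision X m \<times> {0..R}) X H"
      "\<forall>x\<in>subdivision X m. H (x, 0) = x0 \<and> H (x, R) = std_proj m x"
      "\<forall>t\<in>{0..R}. H (subdivision_basepoint x0 m, t) = x0"
    unfolding based_homotopic_def by blast
  have mem: "?p s \<in> subdivision X m" if "s \<in> {0..?L}" for s
    using p that by (auto simp: digitally_continuous_def)
  have "digitally_continuous (prod_adj int_adj int_adj) ({0..?L} \<times> {0..R}) X (\<lambda>(s, t). H (?p s, t))"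
    using H(1) p unfolding digitally_continuous_def prod_adj_def by (auto simp: Pi_iff)
  then show ?thesis
    unfolding loop_homotopic_def
    by (intro exI[of _ R] exI[of _ "\<lambda>(s, t). H (?p s, t)"])
      (use R H mem p_ends std_proj_path_lift[OF lift] in auto)
qed

text \<open>Loops of lengths \<open>M\<close> and \<open>N\<close> have \<open>M + 1\<close> and \<open>N + 1\<close> points, so the factors
  \<open>2 * m * (N + 1)\<close> and \<open>2 * m * (M + 1)\<close> give subdivided domains of equal size, and both are at
  least \<open>2 * m\<close> as the lifting requires.\<close>

lemma loop_rel_total_if_contractible:
  assumes "based_digital_image n X x0" "subdivision_based_contractible X x0"
  shows "loop_rel X x0 = based_loops X x0 \<times> based_loops X x0"
proof -
  have len: "\<And>x. x \<in> X \<Longrightarrow> length x = n" and x0: "x0 \<in> X"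
    using assms(1) by (auto simp: based_digital_image_def digital_image_def)
  obtain m where m: "1 \<le> m" and null: "based_homotopic (subdivision X m)
      (subdivision_basepoint x0 m) X x0 (\<lambda>_. x0) (std_proj m)"
    using contractible_imp_std_proj_nullhomotopic[OF assms(2) x0] by blast
  have "((M, \<alpha>), (N, \<beta>)) \<in> loop_rel X x0"
    if \<alpha>: "(M, \<alpha>) \<in> based_loops X x0" and \<beta>: "(N, \<beta>) \<in> based_loops X x0" for M \<alpha> N \<beta>
  proof -
    have MN: "1 \<le> M" "1 \<le> N" using \<alpha> \<beta> by (auto simp: based_loops_def)
    define k l where "k = 2 * m * (N + 1)" and "l = 2 * m * (M + 1)"
    have kl: "2 * m \<le> k" "2 * m \<le> l"
      using MN m mult_left_mono[of 1 "N + 1" "2 * m"] mult_left_mono[of 1 "M + 1" "2 * m"]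
      by (simp_all add: k_def l_def)
    have eq: "k * (M + 1) = l * (N + 1)" by (simp add: k_def l_def)
    then have eq': "l * N + l - 1 = k * M + k - 1" by (simp add: algebra_simps)
    have "loop_homotopic X x0 (k * M + k - 1) (\<lambda>s. \<alpha> (s div k)) (\<lambda>s. \<beta> (s div l))"
      using loop_nullhomotopic_after_subdivision[OF len null m kl(1) \<alpha>]
        loop_nullhomotopic_after_subdivision[OF len null m kl(2) \<beta>]
      unfolding eq' by (blast intro: loop_homotopic_sym loop_homotopic_trans)
    moreover have "1 \<le> k" "1 \<le> l" using kl m by linarith+
    ultimately show ?thesis using \<alpha> \<beta> eq unfolding loop_rel_def by blast
  qed
  moreover have "loop_rel X x0 \<subseteq> based_loops X x0 \<times> based_loops X x0"
    by (auto simp: loop_rel_def)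
  ultimately show ?thesis by auto
qed

lemma constant_loop_mem: "x0 \<in> X \<Longrightarrow> constant_loop x0 \<in> based_loops X x0"
  by (auto simp: constant_loop_def based_loops_def digitally_continuous_def lattice_adj_refl)

lemma loop_concat_mem:
  assumes "p \<in> based_loops X x0" "q \<in> based_loops X x0"
  shows "loop_concat p q \<in> based_loops X x0"
proof -
  obtain M \<alpha> N \<beta> where pq: "p = (M, \<alpha>)" "q = (N, \<beta>)" by (cases p, cases q) auto
  have M: "1 \<le> M" and \<alpha>: "digitally_continuous int_adj {0..M} X \<alpha>" "\<alpha> 0 = x0" "\<alpha> M = x0"
    and N: "1 \<le> N" and \<beta>: "digitally_continuous int_adj {0..N} X \<beta>" "\<beta> 0 = x0" "\<beta> N = x0"
    using assms by (auto simp: pq based_loops_def)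
  let ?c = "\<lambda>t\<in>{0..M + N + 1}. if t \<le> M then \<alpha> t else \<beta> (t - (M + 1))"
  have "digitally_continuous int_adj {0..M + N + 1} X ?c"
  proof (rule continuous_on_interval)
    fix t assume "t \<in> {0..M + N + 1}"
    then show "?c t \<in> X" using \<alpha>(1) \<beta>(1) by (auto simp: digitally_continuous_def Pi_iff)
  next
    fix t assume t: "0 \<le> t" "t < M + N + 1"
    consider "t < M" | "t = M" | "M < t" by linarith
    then show "lattice_adj (?c t) (?c (t + 1))"
    proof cases
      case 1
      with t \<alpha>(1) N show ?thesis by (auto simp: digitally_continuous_def int_adj_def)
    next
      case 2
      with t \<alpha> \<beta> show ?thesis by (auto simp: lattice_adj_refl)
    next
      case 3
      then have "lattice_adj (\<beta> (t - (M + 1))) (\<beta> (t - M))"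
        using t \<beta>(1) by (auto simp: digitally_continuous_def int_adj_def)
      with 3 t show ?thesis by (simp add: algebra_simps)
    qed
  qed
  with M N \<alpha> \<beta> show ?thesis by (auto simp: pq based_loops_def)
qed

lemma trivial_fundamental_group_if_loop_rel_total:
  assumes x0: "x0 \<in> X" and total: "loop_rel X x0 = based_loops X x0 \<times> based_loops X x0"
  shows "trivial_group (fundamental_group X x0)"
proof -
  let ?L = "based_loops X x0" and ?G = "fundamental_group X x0"
  have ne: "constant_loop x0 \<in> ?L" by (rule constant_loop_mem[OF x0])
  have cls: "loop_rel X x0 `` {p} = ?L" if "p \<in> ?L" for p
    using that total by auto
  have carrier: "carrier ?G = {?L}"
    using ne cls by (auto simp: fundamental_group_def quotient_def)
  have one: "\<one>\<^bsub>?G\<^esub> = ?L"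
    using cls[OF ne] by (simp add: fundamental_group_def)
  have mult: "?L \<otimes>\<^bsub>?G\<^esub> ?L = ?L"
    using ne cls[OF loop_concat_mem] by (auto simp: fundamental_group_def)
  have "group ?G"
    by (rule groupI) (auto simp: carrier one mult)
  then show ?thesis by (simp add: trivial_group_def carrier one)
qed

lemma trivial_group_iso_singleton_group:
  assumes "trivial_group G"
  shows "G \<cong> singleton_group a"
proof -
  have "(\<lambda>_. a) \<in> iso G (singleton_group a)"
    using assms by (auto simp: iso_def bij_betw_def trivial_group_def)
  then show ?thesis by (auto simp: is_iso_def)
qed

theorem corollary3p20:
  fixes n :: nat and X :: "int list set" and x0 :: "int list"
  assumes "based_digital_image n X x0"
    and "subdivision_based_contractible X x0"
  shows "group (fundamental_group X x0) \<and> fundamental_group X x0 \<cong> singleton_group ()"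
proof -
  have "x0 \<in> X" using assms(1) by (simp add: based_digital_image_def)
  then have triv: "trivial_group (fundamental_group X x0)"
    using loop_rel_total_if_contractible[OF assms]
    by (rule trivial_fundamental_group_if_loop_rel_total)
  then show ?thesis
    using trivial_group_iso_singleton_group[OF triv] by (simp add: trivial_group_def)
qed

end
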